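(* Let $A$ be an $\Omega^{(3)}$-algebra over $\Bbbk$ and let $\hat A=A\oplus A'$ be the $\Omega$-algebra constructed from $A$ as in the context. Then the following statements are equivalent: (1) $A$ is a tri-$\mathrm{Var}$-dendriform algebra; (2) $\hat A$ belongs to $\mathrm{Var}$.
   Context: $\Bbbk$ is an arbitrary field. $\Omega=\{\circ_i\mid i\in I\}$ is a set of binary operation symbols; an $\Omega$-algebra is a $\Bbbk$-linear space with bilinear operations $\circ_i$, $i\in I$. An $\Omega^{(3)}$-algebra is a $\Bbbk$-linear space with bilinear operations $\vdash_i,\dashv_i,\perp_i$, $i\in I$. $\mathrm{Var}$ is the variety of $\Omega$-algebras defined by a family $S$ of poly-linear identities of degrees greater than one: each $f\in S$ of degree $n$ is a $\Bbbk$-linear combination of non-associative $\Omega$-monomials in which each of $x_1,\dots,x_n$ occurs exactly once (in any order and with any bracketing). For a poly-linear $\Omega$-monomial $v$, let $v^*$ be the $\Omega^{(3)}$-polynomial obtained by replacing each $\circ_j$ in $v$ with $\vdash_j+\dashv_j+\perp_j$ (and expanding). For a poly-linear $\Omega$-monomial $u$ and a nonempty set $H$ of indices of variables occurring in $u$ ("emphasized" variables), define the $\Omega^{(3)}$-polynomial $\Phi^*(u^H)$ recursively: if $u$ is a single variable, $\Phi^*(u^H)=u$; if $u=v\circ_i w$, let $H_1$ (resp. $H_2$) be the set of $k\in H$ such that $x_k$ occurs in $v$ (resp. $w$), and put $$\Phi^*(u^H)=\begin{cases}\Phi^*(v^{H_1})\perp_i\Phi^*(w^{H_2}), & H_1,H_2\neq\emptyset,\\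 v^*\vdash_i\Phi^*(w^{H}), & H_1=\emptyset,\\ \Phi^*(v^{H})\dashv_i w^*, & H_2=\emptyset.\end{cases}$$ For $f=\sum_\xi\alpha_\xi u_\xi$ of degree $n$ and $\emptyset\ne H\subseteq\{1,\dots,n\}$ put $\Phi^*(f^H)=\sum_\xi\alpha_\xi\Phi^*(u_\xi^H)$. A tri-$\mathrm{Var}$-dendriform algebra is an $\Omega^{(3)}$-algebra satisfying the identities $\Phi^*(f^H)=0$ for all $f\in S$ and all nonempty $H\subseteq\{1,\dots,\deg f\}$. For an $\Omega^{(3)}$-algebra $A$, let $A'$ be an isomorphic copy of the linear space $A$ ($a\leftrightarrow a'$), and let $\hat A=A\oplus A'$ be the $\Omega$-algebra with $$a\circ_i b=a\vdash_i b+a\dashv_i b+a\perp_i b,\quad a\circ_i b'=(a\vdash_i b)',\quad a'\circ_i b=(a\dashv_i b)',\quad a'\circ_i b'=(a\perp_i b)'$$ for $a,b\in A$, $i\in I$. *)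

theory Defs
  imports "HOL-Analysis.Product_Vector" "HOL-Library.Poly_Mapping"
begin

section \<open>Non-associative polynomials\<close>

text \<open>
  Non-associative monomials over a set of binary operation symbols, given as a type \<open>'o\<close>, in the
  variables \<open>x\<^sub>k\<close> (written \<open>Variable k\<close>). Polynomials are the elements of the free algebra, i.e.
  finitely supported functions from monomials to coefficients.
\<close>

datatype 'o monomial = Variable nat | Product 'o "'o monomial" "'o monomial"

type_synonym ('o, 'k) npoly = "'o monomial \<Rightarrow>\<^sub>0 'k"

primrec var_list :: "'o monomial \<Rightarrow> nat list" where
  "var_list (Variable k) = [k]"
| "var_list (Product i v w) = var_list v @ var_list w"

abbreviation vars :: "'o monomial \<Rightarrow> nat set" where
  "vars u \<equiv> set (var_list u)"

definition polylinear_monomial :: "nat \<Rightarrow> 'o monomial \<Rightarrow> bool" where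
  "polylinear_monomial n u \<longleftrightarrow> distinct (var_list u) \<and> vars u = {1..n}"

text \<open>The degree \<open>n\<close> is determined by \<open>f\<close>, except that \<open>0\<close> is poly-linear of every degree.\<close>

definition polylinear :: "nat \<Rightarrow> ('o, 'k::zero) npoly \<Rightarrow> bool" where
  "polylinear n f \<longleftrightarrow> (\<forall>u\<in>Poly_Mapping.keys f. polylinear_monomial n u)"

definition npoly_scale :: "'k::semiring_0 \<Rightarrow> ('o, 'k) npoly \<Rightarrow> ('o, 'k) npoly" where
  "npoly_scale c p = Poly_Mapping.map ((*) c) p"

text \<open>The operations of the free algebra: bilinear extensions of \<open>Product i\<close>.\<close>

definition npoly_prod ::
    "'o \<Rightarrow> ('o, 'k::semiring_0) npoly \<Rightarrow> ('o, 'k) npoly \<Rightarrow> ('o, 'k) npoly" where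
  "npoly_prod i p q =
     (\<Sum>v\<in>Poly_Mapping.keys p. \<Sum>w\<in>Poly_Mapping.keys q.
        Poly_Mapping.single (Product i v w) (Poly_Mapping.lookup p v * Poly_Mapping.lookup q w))"


section \<open>Algebras and varieties\<close>

locale omega_algebra = vector_space scl
  for scl :: "'k::field \<Rightarrow> 'a::ab_group_add \<Rightarrow> 'a" +
  fixes opr :: "'o \<Rightarrow> 'a \<Rightarrow> 'a \<Rightarrow> 'a"
  assumes linear_left: "Vector_Spaces.linear scl scl (\<lambda>a. opr i a b)"
    and linear_right: "Vector_Spaces.linear scl scl (\<lambda>b. opr i a b)"

primrec eval_monomial :: "('o \<Rightarrow> 'a \<Rightarrow> 'a \<Rightarrow> 'a) \<Rightarrow> (nat \<Rightarrow> 'a) \<Rightarrow> 'o monomial \<Rightarrow> 'a" where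
  "eval_monomial opr \<rho> (Variable k) = \<rho> k"
| "eval_monomial opr \<rho> (Product i v w) = opr i (eval_monomial opr \<rho> v) (eval_monomial opr \<rho> w)"

definition eval_npoly ::
    "('k::zero \<Rightarrow> 'a::comm_monoid_add \<Rightarrow> 'a) \<Rightarrow> ('o \<Rightarrow> 'a \<Rightarrow> 'a \<Rightarrow> 'a) \<Rightarrow> (nat \<Rightarrow> 'a) \<Rightarrow>
     ('o, 'k) npoly \<Rightarrow> 'a" where
  "eval_npoly scl opr \<rho> f =
     (\<Sum>u\<in>Poly_Mapping.keys f. scl (Poly_Mapping.lookup f u) (eval_monomial opr \<rho> u))"

definition satisfies_identity ::
    "('k::zero \<Rightarrow> 'a::comm_monoid_add \<Rightarrow> 'a) \<Rightarrow> ('o \<Rightarrow> 'a \<Rightarrow> 'a \<Rightarrow> 'a) \<Rightarrow> ('o, 'k) npoly \<Rightarrow> bool" where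
  "satisfies_identity scl opr f \<longleftrightarrow> (\<forall>\<rho>. eval_npoly scl opr \<rho> f = 0)"

definition in_variety ::
    "('o, 'k::field) npoly set \<Rightarrow> ('k \<Rightarrow> 'a::ab_group_add \<Rightarrow> 'a) \<Rightarrow> ('o \<Rightarrow> 'a \<Rightarrow> 'a \<Rightarrow> 'a) \<Rightarrow> bool" where
  "in_variety S scl opr \<longleftrightarrow>
     omega_algebra scl opr \<and> (\<forall>f\<in>S. satisfies_identity scl opr f)"


section \<open>Tri-dendriform identities\<close>

text \<open>Each symbol \<open>\<circ>\<^sub>i\<close> gives rise to three symbols \<open>\<turnstile>\<^sub>i\<close>, \<open>\<stileturn>\<^sub>i\<close>, \<open>\<bottom>\<^sub>i\<close>.\<close>

datatype 'i op3 = RightT 'i (\<open>\<turnstile>\<^sub>_\<close> [1000] 1000) | LeftT 'i (\<open>\<stileturn>\<^sub>_\<close> [1000] 1000) | PerpT 'i (\<open>\<bottom>\<^sub>_\<close> [1000] 1000)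

primrec star :: "'i monomial \<Rightarrow> ('i op3, 'k::comm_semiring_1) npoly" where
  "star (Variable k) = Poly_Mapping.single (Variable k) 1"
| "star (Product i v w) =
     npoly_prod (\<turnstile>\<^sub>i) (star v) (star w) + npoly_prod (\<stileturn>\<^sub>i) (star v) (star w)
     + npoly_prod (\<bottom>\<^sub>i) (star v) (star w)"

text \<open>
  \<open>Phi_monomial u H\<close> is \<open>\<Phi>\<^sup>*(u\<^sup>H)\<close>; it is meaningful only if \<open>H\<close> is a nonempty subset of \<open>vars u\<close>
  and \<open>u\<close> is poly-linear.
\<close>

primrec Phi_monomial :: "'i monomial \<Rightarrow> nat set \<Rightarrow> ('i op3, 'k::comm_semiring_1) npoly" where
  "Phi_monomial (Variable k) H = Poly_Mapping.single (Variable k) 1"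
| "Phi_monomial (Product i v w) H =
     (let H1 = H \<inter> vars v; H2 = H \<inter> vars w in
      if H1 \<noteq> {} \<and> H2 \<noteq> {} then npoly_prod (\<bottom>\<^sub>i) (Phi_monomial v H1) (Phi_monomial w H2)
      else if H1 = {} then npoly_prod (\<turnstile>\<^sub>i) (star v) (Phi_monomial w H)
      else npoly_prod (\<stileturn>\<^sub>i) (Phi_monomial v H) (star w))"

definition Phi :: "('i, 'k::comm_semiring_1) npoly \<Rightarrow> nat set \<Rightarrow> ('i op3, 'k) npoly" where
  "Phi f H = (\<Sum>u\<in>Poly_Mapping.keys f. npoly_scale (Poly_Mapping.lookup f u) (Phi_monomial u H))"

definition tri_dendriform_identities ::
    "('i, 'k::comm_semiring_1) npoly set \<Rightarrow> ('i op3, 'k) npoly set" where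
  "tri_dendriform_identities S =
     {Phi f H | f n H. f \<in> S \<and> polylinear n f \<and> H \<noteq> {} \<and> H \<subseteq> {1..n}}"

definition tri_dendriform ::
    "('i, 'k::field) npoly set \<Rightarrow> ('k \<Rightarrow> 'a::ab_group_add \<Rightarrow> 'a) \<Rightarrow> ('i op3 \<Rightarrow> 'a \<Rightarrow> 'a \<Rightarrow> 'a) \<Rightarrow> bool" where
  "tri_dendriform S scl opr3 \<longleftrightarrow> in_variety (tri_dendriform_identities S) scl opr3"


section \<open>The algebra \<open>A \<oplus> A'\<close>\<close>

text \<open>
  The carrier is \<open>'a \<times> 'a\<close>, where \<open>(a, b)\<close> stands for \<open>a + b'\<close>. The operations are the bilinear
  extensions of the products of the summands, listed in \<open>hat_op_summands\<close> below.
\<close>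

abbreviation hat_scale :: "('k::field \<Rightarrow> 'a::ab_group_add \<Rightarrow> 'a) \<Rightarrow> 'k \<Rightarrow> 'a \<times> 'a \<Rightarrow> 'a \<times> 'a" where
  "hat_scale scl \<equiv> module_prod.scale scl scl"

definition hat_op ::
    "('i op3 \<Rightarrow> 'a::ab_group_add \<Rightarrow> 'a \<Rightarrow> 'a) \<Rightarrow> 'i \<Rightarrow> 'a \<times> 'a \<Rightarrow> 'a \<times> 'a \<Rightarrow> 'a \<times> 'a" where
  "hat_op opr3 i = (\<lambda>(a, a') (b, b').
     (opr3 (\<turnstile>\<^sub>i) a b + opr3 (\<stileturn>\<^sub>i) a b + opr3 (\<bottom>\<^sub>i) a b,
      opr3 (\<turnstile>\<^sub>i) a b' + opr3 (\<stileturn>\<^sub>i) a' b + opr3 (\<bottom>\<^sub>i) a' b'))"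

context omega_algebra
begin

lemmas hom_left = Vector_Spaces.linear.axioms(3)[OF linear_left]
lemmas hom_right = Vector_Spaces.linear.axioms(3)[OF linear_right]

lemma opr_zero [simp]: "opr i 0 b = 0" "opr i a 0 = 0"
  by (rule module_hom.zero[OF hom_left], rule module_hom.zero[OF hom_right])

lemma opr_add:
  "opr i (a + a') b = opr i a b + opr i a' b" "opr i a (b + b') = opr i a b + opr i a b'"
  by (rule module_hom.add[OF hom_left], rule module_hom.add[OF hom_right])

lemma opr_scl:
  "opr i (scl c a) b = scl c (opr i a b)" "opr i a (scl c b) = scl c (opr i a b)"
  by (rule module_hom.scale[OF hom_left], rule module_hom.scale[OF hom_right])

end

lemma hat_op_summands:
  assumes "omega_algebra scl opr3"
  shows "hat_op opr3 i (a, 0) (b, 0) = (opr3 (\<turnstile>\<^sub>i) a b + opr3 (\<stileturn>\<^sub>i) a b + opr3 (\<bottom>\<^sub>i) a b, 0)"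
    and "hat_op opr3 i (a, 0) (0, b) = (0, opr3 (\<turnstile>\<^sub>i) a b)"
    and "hat_op opr3 i (0, a) (b, 0) = (0, opr3 (\<stileturn>\<^sub>i) a b)"
    and "hat_op opr3 i (0, a) (0, b) = (0, opr3 (\<bottom>\<^sub>i) a b)"
proof -
  interpret omega_algebra scl opr3 by fact
  show "hat_op opr3 i (a, 0) (b, 0) = (opr3 (\<turnstile>\<^sub>i) a b + opr3 (\<stileturn>\<^sub>i) a b + opr3 (\<bottom>\<^sub>i) a b, 0)"
    "hat_op opr3 i (a, 0) (0, b) = (0, opr3 (\<turnstile>\<^sub>i) a b)"
    "hat_op opr3 i (0, a) (b, 0) = (0, opr3 (\<stileturn>\<^sub>i) a b)"
    "hat_op opr3 i (0, a) (0, b) = (0, opr3 (\<bottom>\<^sub>i) a b)"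
    by (simp_all add: hat_op_def)
qed

lemma hat_omega_algebra:
  assumes "omega_algebra scl opr3"
  shows "omega_algebra (hat_scale scl) (hat_op opr3)"
proof -
  interpret omega_algebra scl opr3 by fact
  interpret P: vector_space_prod scl scl ..
  show ?thesis
    by unfold_locales
      (auto simp: hat_op_def P.scale_prod opr_add opr_scl scale_right_distrib add_ac split: prod.splits)
qed

end

theory Submission
  imports Defs
begin

text \<open>
  Evaluate a monomial \<open>u\<close> in \<open>A \<oplus> A'\<close> with the variables in \<open>H\<close> taking values in \<open>A'\<close> and the
  others in \<open>A\<close>: the result is the value of \<open>\<Phi>\<^sup>*(u\<^sup>H)\<close> in \<open>A'\<close> if \<open>H\<close> meets \<open>u\<close>, and that of \<open>u\<^sup>*\<close> in
  \<open>A\<close> otherwise. Since \<open>f\<close> is poly-linear, it vanishes on \<open>A \<oplus> A'\<close> iff it vanishes under all such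
  assignments. So \<open>f = 0\<close> on \<open>A \<oplus> A'\<close> amounts to the identities \<open>\<Phi>\<^sup>*(f\<^sup>H) = 0\<close> together with
  \<open>f\<^sup>* = 0\<close>, and the latter follows from the former: the diagonal \<open>{a + a'}\<close> is closed under the
  operations, and comparing the two components there gives \<open>f\<^sup>* = (\<Sum>H\<noteq>{}. \<Phi>\<^sup>*(f\<^sup>H))\<close>.
\<close>

context omega_algebra
begin

text \<open>Allows a common index set: cancellation can make the supports of \<open>f + g\<close>
  and \<open>npoly_scale c f\<close> smaller than those they come from.\<close>

lemma eval_npoly_superset:
  assumes "finite M" "Poly_Mapping.keys f \<subseteq> M"
  shows "eval_npoly scl opr \<rho> f
    = (\<Sum>u\<in>M. scl (Poly_Mapping.lookup f u) (eval_monomial opr \<rho> u))"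
  unfolding eval_npoly_def
  by (rule sum.mono_neutral_left) (use assms in \<open>auto simp: in_keys_iff\<close>)

lemma eval_npoly_zero [simp]: "eval_npoly scl opr \<rho> 0 = 0"
  by (simp add: eval_npoly_def)

lemma eval_npoly_single [simp]:
  "eval_npoly scl opr \<rho> (Poly_Mapping.single u c) = scl c (eval_monomial opr \<rho> u)"
  by (subst eval_npoly_superset[where M = "{u}"]) auto

lemma eval_npoly_add [simp]:
  "eval_npoly scl opr \<rho> (f + g) = eval_npoly scl opr \<rho> f + eval_npoly scl opr \<rho> g"
proof -
  let ?M = "Poly_Mapping.keys f \<union> Poly_Mapping.keys g"
  show ?thesis
    by (simp add: eval_npoly_superset[where M = ?M] Poly_Mapping.keys_add lookup_add
        scale_left_distrib sum.distrib)
qed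

lemma eval_npoly_sum:
  "eval_npoly scl opr \<rho> (\<Sum>x\<in>M. F x) = (\<Sum>x\<in>M. eval_npoly scl opr \<rho> (F x))"
  by (induction M rule: infinite_finite_induct) auto

lemma eval_npoly_scale [simp]:
  "eval_npoly scl opr \<rho> (npoly_scale c f) = scl c (eval_npoly scl opr \<rho> f)"
proof -
  have lookup: "Poly_Mapping.lookup (npoly_scale c f) u = c * Poly_Mapping.lookup f u" for u
    by (simp add: npoly_scale_def Poly_Mapping.map.rep_eq when_def)
  then have "Poly_Mapping.keys (npoly_scale c f) \<subseteq> Poly_Mapping.keys f"
    by (auto simp: in_keys_iff)
  then show ?thesis
    by (simp add: eval_npoly_superset[where M = "Poly_Mapping.keys f"] lookup scale_sum_right)
qed

lemma opr_sum_sum: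
  "opr i (\<Sum>x\<in>M. F x) (\<Sum>y\<in>N. G y) = (\<Sum>x\<in>M. \<Sum>y\<in>N. opr i (F x) (G y))"
  by (simp only: module_hom.sum[OF hom_left, where g = F]) (simp only: module_hom.sum[OF hom_right])

lemma eval_npoly_prod [simp]:
  "eval_npoly scl opr \<rho> (npoly_prod i f g)
    = opr i (eval_npoly scl opr \<rho> f) (eval_npoly scl opr \<rho> g)"
  unfolding npoly_prod_def eval_npoly_sum
  by (simp add: eval_npoly_def[of _ _ _ f] eval_npoly_def[of _ _ _ g] opr_sum_sum opr_scl mult.commute)

end

lemma eval_monomial_cong:
  "(\<And>k. k \<in> vars u \<Longrightarrow> \<rho> k = \<rho>' k) \<Longrightarrow> eval_monomial opr \<rho> u = eval_monomial opr \<rho>' u"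
  by (induction u) auto

text \<open>A subset of a disjoint union is a pair of subsets, just as a choice of variables in a
  product splits between its factors.\<close>

lemma sum_Pow_Un_disjoint:
  assumes "finite A" "finite B" "A \<inter> B = {}"
  shows "(\<Sum>H\<in>Pow (A \<union> B). F H) = (\<Sum>K\<in>Pow A. \<Sum>L\<in>Pow B. F (K \<union> L))"
proof -
  have "(\<Sum>H\<in>Pow (A \<union> B). F H) = (\<Sum>(K, L)\<in>Pow A \<times> Pow B. F (K \<union> L))"
    by (rule sum.reindex_bij_witness[where i = "\<lambda>(K, L). K \<union> L" and j = "\<lambda>H. (H \<inter> A, H \<inter> B)"])
      (use assms(3) in \<open>auto simp flip: Int_Un_distrib simp: Int_absorb2\<close>)
  then show ?thesis
    by (simp add: sum.cartesian_product)
qed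

context omega_algebra
begin

text \<open>Multilinear expansion: as no variable repeats, each one chooses between
  \<open>a k\<close> and \<open>b k\<close> independently, and \<open>H\<close> records where
  \<open>b\<close> is chosen.\<close>

lemma eval_monomial_plus:
  assumes "distinct (var_list u)"
  shows "eval_monomial opr (\<lambda>k. a k + b k) u
    = (\<Sum>H\<in>Pow (vars u). eval_monomial opr (\<lambda>k. if k \<in> H then b k else a k) u)"
  using assms
proof (induction u)
  case (Variable k)
  then show ?case by (simp add: Pow_insert add.commute)
next
  case (Product i v w)
  let ?\<rho> = "\<lambda>H k. if k \<in> H then b k else a k"
  have disj: "vars v \<inter> vars w = {}" using Product.prems by auto
  have "eval_monomial opr (\<lambda>k. a k + b k) (Product i v w)
      = (\<Sum>K\<in>Pow (vars v). \<Sum>L\<in>Pow (vars w).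
          opr i (eval_monomial opr (?\<rho> K) v) (eval_monomial opr (?\<rho> L) w))"
    using Product by (simp add: opr_sum_sum)
  also have "\<dots> = (\<Sum>K\<in>Pow (vars v). \<Sum>L\<in>Pow (vars w).
      eval_monomial opr (?\<rho> (K \<union> L)) (Product i v w))"
  \<comment> \<open>By disjointness, \<open>K \<union> L\<close> makes the same choices as
    \<open>K\<close> on \<open>vars v\<close> and as \<open>L\<close> on
    \<open>vars w\<close>.\<close>
  proof (intro sum.cong refl)
    fix K L assume "K \<in> Pow (vars v)" "L \<in> Pow (vars w)"
    then have "eval_monomial opr (?\<rho> K) v = eval_monomial opr (?\<rho> (K \<union> L)) v"
      "eval_monomial opr (?\<rho> L) w = eval_monomial opr (?\<rho> (K \<union> L)) w"
      using disj by (auto intro!: eval_monomial_cong)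
    then show "opr i (eval_monomial opr (?\<rho> K) v) (eval_monomial opr (?\<rho> L) w)
        = eval_monomial opr (?\<rho> (K \<union> L)) (Product i v w)"
      by simp
  qed
  also have "\<dots> = (\<Sum>H\<in>Pow (vars (Product i v w)). eval_monomial opr (?\<rho> H) (Product i v w))"
    using disj by (simp only: var_list.simps set_append) (simp add: sum_Pow_Un_disjoint)
  finally show ?case .
qed

text \<open>All monomials of \<open>f\<close> have the same variables, so their expansions share the
  index set \<open>Pow {1..n}\<close>.\<close>

lemma eval_npoly_plus:
  assumes "polylinear n f"
  shows "eval_npoly scl opr (\<lambda>k. a k + b k) f
    = (\<Sum>H\<in>Pow {1..n}. eval_npoly scl opr (\<lambda>k. if k \<in> H then b k else a k) f)"
  unfolding eval_npoly_def sum.swap[of _ _ "Pow {1..n}"]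
proof (intro sum.cong refl)
  fix u assume "u \<in> Poly_Mapping.keys f"
  then have "distinct (var_list u)" "vars u = {1..n}"
    using assms by (auto simp: polylinear_def polylinear_monomial_def)
  then show "scl (Poly_Mapping.lookup f u) (eval_monomial opr (\<lambda>k. a k + b k) u)
      = (\<Sum>H\<in>Pow {1..n}. scl (Poly_Mapping.lookup f u)
          (eval_monomial opr (\<lambda>k. if k \<in> H then b k else a k) u))"
    by (simp add: eval_monomial_plus scale_sum_right)
qed

end

text \<open>The recursion passes on restricted sets in the \<open>\<bottom>\<close> case but
  \<open>H\<close> itself in the other two; this reconciles the two forms.\<close>

lemma Phi_monomial_Int_vars: "Phi_monomial u (H \<inter> vars u) = Phi_monomial u H"
proof (induction u arbitrary: H)
  case (Variable k)
  show ?case by simp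
next
  case (Product i v w)
  have "H \<inter> (vars v \<union> vars w) \<inter> vars v = H \<inter> vars v"
    "H \<inter> (vars v \<union> vars w) \<inter> vars w = H \<inter> vars w"
    by auto
  with Product.IH[of "H \<inter> (vars v \<union> vars w)"] Product.IH[of H] show ?case
    by (simp add: Let_def)
qed

definition split_assignment :: "nat set \<Rightarrow> (nat \<Rightarrow> 'a::zero) \<Rightarrow> nat \<Rightarrow> 'a \<times> 'a" where
  "split_assignment H \<sigma> k = (if k \<in> H then (0, \<sigma> k) else (\<sigma> k, 0))"

locale omega3_algebra = A: omega_algebra scl opr3
  for scl :: "'k::field \<Rightarrow> 'a::ab_group_add \<Rightarrow> 'a"
    and opr3 :: "'i op3 \<Rightarrow> 'a \<Rightarrow> 'a \<Rightarrow> 'a"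
begin

sublocale hat: omega_algebra "hat_scale scl" "hat_op opr3"
  by (rule hat_omega_algebra) (rule A.omega_algebra_axioms)

sublocale P: vector_space_prod scl scl ..

abbreviation "eval3 \<equiv> eval_npoly scl opr3"
abbreviation "eval_hat \<equiv> eval_npoly (hat_scale scl) (hat_op opr3)"

lemma eval3_Phi:
  "eval3 \<sigma> (Phi f H)
    = (\<Sum>u\<in>Poly_Mapping.keys f. scl (Poly_Mapping.lookup f u) (eval3 \<sigma> (Phi_monomial u H)))"
  by (simp add: Phi_def A.eval_npoly_sum)

text \<open>The products of summands under \<open>hat_op\<close> mirror the cases of
  \<open>Phi_monomial\<close>: two factors in A' give \<open>\<bottom>\<close>, mixed ones
  \<open>\<turnstile>\<close> or \<open>\<stileturn>\<close>, and two factors in A the sum of all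
  three, as in \<open>star\<close>.\<close>

lemma eval_monomial_split_assignment:
  "eval_monomial (hat_op opr3) (split_assignment H \<sigma>) u
    = (if H \<inter> vars u = {} then (eval3 \<sigma> (star u), 0) else (0, eval3 \<sigma> (Phi_monomial u H)))"
proof (induction u)
  case (Variable k)
  show ?case by (simp add: split_assignment_def)
next
  case (Product i v w)
  have "H \<inter> vars (Product i v w) = {} \<longleftrightarrow> H \<inter> vars v = {} \<and> H \<inter> vars w = {}"
    by auto
  with Product.IH show ?case
    by (simp add: hat_op_def Let_def Phi_monomial_Int_vars)
qed

text \<open>Every monomial of \<open>f\<close> contains all the variables, so \<open>H\<close> meets
  each of them and all values lie in A'.\<close>

lemma eval_hat_split_assignment:
  assumes "polylinear n f" "H \<noteq> {}" "H \<subseteq> {1..n}"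
  shows "eval_hat (split_assignment H \<sigma>) f = (0, eval3 \<sigma> (Phi f H))"
proof -
  have "eval_hat (split_assignment H \<sigma>) f
      = (\<Sum>u\<in>Poly_Mapping.keys f. (0, scl (Poly_Mapping.lookup f u) (eval3 \<sigma> (Phi_monomial u H))))"
    unfolding eval_npoly_def[of _ "hat_op opr3"]
  proof (intro sum.cong refl)
    fix u assume "u \<in> Poly_Mapping.keys f"
    then have "vars u = {1..n}"
      using assms(1) by (auto simp: polylinear_def polylinear_monomial_def)
    with assms(2,3) have "H \<inter> vars u \<noteq> {}" by auto
    then show "hat_scale scl (Poly_Mapping.lookup f u)
          (eval_monomial (hat_op opr3) (split_assignment H \<sigma>) u)
        = (0, scl (Poly_Mapping.lookup f u) (eval3 \<sigma> (Phi_monomial u H)))"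
      by (simp add: eval_monomial_split_assignment P.scale_prod)
  qed
  then show ?thesis
    by (simp add: eval3_Phi sum_prod)
qed

text \<open>When each value is split into its A and A' parts and \<open>f\<close> is expanded, only
  the term \<open>H = {}\<close> escapes the hypothesis.\<close>

lemma eval_hat_eq_eval_hat_left:
  assumes "polylinear n f"
    and Phi: "\<And>H \<sigma>. H \<noteq> {} \<Longrightarrow> H \<subseteq> {1..n} \<Longrightarrow> eval3 \<sigma> (Phi f H) = 0"
  shows "eval_hat \<rho> f = eval_hat (\<lambda>k. (fst (\<rho> k), 0)) f"
proof -
  let ?\<rho> = "\<lambda>H k. if k \<in> H then (0, snd (\<rho> k)) else (fst (\<rho> k), 0)"
  \<comment> \<open>The assignment \<open>\<sigma>\<close> needed here varies with \<open>H\<close>,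
    which is harmless as \<open>Phi\<close> is assumed for every \<open>\<sigma>\<close>.\<close>
  have "?\<rho> H = split_assignment H (\<lambda>k. if k \<in> H then snd (\<rho> k) else fst (\<rho> k))" for H
    by (auto simp: split_assignment_def)
  then have zero: "eval_hat (?\<rho> H) f = 0" if "H \<in> Pow {1..n} - {{}}" for H
    using that eval_hat_split_assignment[OF assms(1), of H] Phi[of H] by (simp add: zero_prod_def)
  have "eval_hat \<rho> f = eval_hat (\<lambda>k. (fst (\<rho> k), 0) + (0, snd (\<rho> k))) f"
    by simp
  also have "\<dots> = (\<Sum>H\<in>Pow {1..n}. eval_hat (?\<rho> H) f)"
    by (rule hat.eval_npoly_plus[OF assms(1)])
  also have "\<dots> = (\<Sum>H\<in>{{}}. eval_hat (?\<rho> H) f)"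
    by (rule sum.mono_neutral_right) (use zero in auto)
  finally show ?thesis by simp
qed

lemma eval_monomial_hat_diagonal:
  "fst (eval_monomial (hat_op opr3) (\<lambda>k. (\<sigma> k, \<sigma> k)) u)
    = snd (eval_monomial (hat_op opr3) (\<lambda>k. (\<sigma> k, \<sigma> k)) u)"
  by (induction u) (auto simp: hat_op_def split_beta)

lemma eval_monomial_hat_left:
  "snd (eval_monomial (hat_op opr3) (\<lambda>k. (\<sigma> k, 0)) u) = 0"
  by (induction u) (auto simp: hat_op_def split_beta)

text \<open>The value of \<open>f\<close> lies both in A and on the diagonal, and these meet only in
  0.\<close>

lemma eval_hat_eq_zero:
  assumes "polylinear n f"
    and Phi: "\<And>H \<sigma>. H \<noteq> {} \<Longrightarrow> H \<subseteq> {1..n} \<Longrightarrow> eval3 \<sigma> (Phi f H) = 0"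
  shows "eval_hat \<rho> f = 0"
proof -
  let ?\<sigma> = "\<lambda>k. fst (\<rho> k)"
  let ?diag = "eval_hat (\<lambda>k. (?\<sigma> k, ?\<sigma> k)) f" and ?left = "eval_hat (\<lambda>k. (?\<sigma> k, 0)) f"
  \<comment> \<open>The value of \<open>f\<close> depends only on the A parts, which
    \<open>\<rho>\<close> shares with the diagonal assignment.\<close>
  have eq: "eval_hat \<rho> f = ?left" and diag_eq: "?diag = ?left"
    using eval_hat_eq_eval_hat_left[OF assms, of \<rho>] eval_hat_eq_eval_hat_left[OF assms, of "\<lambda>k. (?\<sigma> k, ?\<sigma> k)"]
    by simp_all
  have "fst ?diag = snd ?diag"
    by (simp add: eval_npoly_def fst_sum snd_sum P.scale_def eval_monomial_hat_diagonal)
  moreover have "snd ?left = 0"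
    by (simp add: eval_npoly_def snd_sum P.scale_def eval_monomial_hat_left)
  ultimately show ?thesis
    by (simp add: eq diag_eq prod_eq_iff)
qed

lemma tri_dendriform_iff_in_variety_hat:
  assumes "\<forall>f\<in>S. \<exists>n. polylinear n f"
  shows "tri_dendriform S scl opr3 \<longleftrightarrow> in_variety S (hat_scale scl) (hat_op opr3)"
proof
  assume tri: "tri_dendriform S scl opr3"
  have "eval_hat \<rho> f = 0" if f: "f \<in> S" for f \<rho>
  proof -
    obtain n where n: "polylinear n f" using bspec[OF assms f] ..
    have "eval3 \<sigma> (Phi f H) = 0" if "H \<noteq> {}" "H \<subseteq> {1..n}" for H \<sigma>
    proof -
      have "Phi f H \<in> tri_dendriform_identities S"
        unfolding tri_dendriform_identities_def using f n that by blast
      with tri show ?thesis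
        by (simp add: tri_dendriform_def in_variety_def satisfies_identity_def)
    qed
    then show ?thesis by (rule eval_hat_eq_zero[OF n])
  qed
  then show "in_variety S (hat_scale scl) (hat_op opr3)"
    by (simp add: in_variety_def satisfies_identity_def hat.omega_algebra_axioms)
next
  assume var: "in_variety S (hat_scale scl) (hat_op opr3)"
  \<comment> \<open>This value is the second component of \<open>f\<close> at
    \<open>split_assignment H \<sigma>\<close>.\<close>
  have "eval3 \<sigma> (Phi f H) = 0"
    if "f \<in> S" "polylinear n f" "H \<noteq> {}" "H \<subseteq> {1..n}" for f n H \<sigma>
    using var \<open>f \<in> S\<close> eval_hat_split_assignment[OF that(2-4), of \<sigma>]
    by (simp add: in_variety_def satisfies_identity_def zero_prod_def)
  then have "\<forall>g\<in>tri_dendriform_identities S. satisfies_identity scl opr3 g"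
    unfolding tri_dendriform_identities_def satisfies_identity_def by blast
  with A.omega_algebra_axioms show "tri_dendriform S scl opr3"
    by (simp add: tri_dendriform_def in_variety_def)
qed

end

theorem theorem1:
  fixes S :: "('i, 'k::field) npoly set"
    and scl :: "'k \<Rightarrow> 'a::ab_group_add \<Rightarrow> 'a"
    and opr3 :: "'i op3 \<Rightarrow> 'a \<Rightarrow> 'a \<Rightarrow> 'a"
  assumes "\<forall>f\<in>S. \<exists>n>1. polylinear n f"
    and "omega_algebra scl opr3"
  shows "tri_dendriform S scl opr3 \<longleftrightarrow> in_variety S (hat_scale scl) (hat_op opr3)"
proof (rule omega3_algebra.tri_dendriform_iff_in_variety_hat)
  show "omega3_algebra scl opr3"
    using assms(2) by (rule omega3_algebra.intro)
  show "\<forall>f\<in>S. \<exists>n. polylinear n f"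
    using assms(1) by auto
qed

end
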